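(* Let $H$ be a connected graph of order $p \geq 5$ with cyclomatic number $v(H) = 1$. If $H$ contains a cycle with $k$ vertices, where $3 \leq k \leq p-2$, then for every $n \geq p$ $$\left\lfloor\frac{n}{k-1}\right\rfloor\binom{k-1}{2} + \binom{r}{2} + \left\lceil\frac{n}{k-1}\right\rceil \leq rb(K_n, H) \leq (p-2)n - p \cdot \frac{p-3}{2},$$ where $r$ is the residue of $n$ modulo $k-1$.
   Context: For a graph $H$ and an integer $n$, the rainbow number $rb(K_n,H)$ is the minimum number $m$ such that every edge-colouring of the complete graph $K_n$ using at least $m$ colours contains a rainbow copy of $H$, i.e. a subgraph isomorphic to $H$ whose edges all have distinct colours. The cyclomatic number of a connected graph $G$ is $v(G) = |E(G)| - |V(G)| + 1$. *)

theory Defs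
  imports Complex_Main
begin

record 'a graph =
  verts :: "'a set"
  edges :: "'a set set"

definition simple_graph :: "'a graph \<Rightarrow> bool" where
  "simple_graph G \<longleftrightarrow>
     finite (verts G) \<and> (\<forall>e\<in>edges G. e \<subseteq> verts G \<and> card e = 2)"

definition complete_graph :: "nat \<Rightarrow> nat graph" where
  "complete_graph n = \<lparr> verts = {..<n}, edges = {e. e \<subseteq> {..<n} \<and> card e = 2} \<rparr>"

definition connected_graph :: "'a graph \<Rightarrow> bool" where
  "connected_graph G \<longleftrightarrow> verts G \<noteq> {} \<and>
     (\<forall>u\<in>verts G. \<forall>v\<in>verts G. (u, v) \<in> {(x, y). {x, y} \<in> edges G}\<^sup>*)"

definition cyclomatic_number :: "'a graph \<Rightarrow> int" where
  "cyclomatic_number G = int (card (edges G)) - int (card (verts G)) + 1"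

definition is_cycle :: "'a graph \<Rightarrow> 'a list \<Rightarrow> bool" where
  "is_cycle G vs \<longleftrightarrow> 3 \<le> length vs \<and> distinct vs \<and> set vs \<subseteq> verts G \<and>
     (\<forall>i<length vs. {vs ! i, vs ! (Suc i mod length vs)} \<in> edges G)"

definition is_subgraph :: "'a graph \<Rightarrow> 'a graph \<Rightarrow> bool" where
  "is_subgraph S G \<longleftrightarrow> simple_graph S \<and> verts S \<subseteq> verts G \<and> edges S \<subseteq> edges G"

definition isomorphic :: "'a graph \<Rightarrow> 'b graph \<Rightarrow> bool" where
  "isomorphic G H \<longleftrightarrow> (\<exists>f. bij_betw f (verts G) (verts H) \<and>
     (\<forall>u\<in>verts G. \<forall>v\<in>verts G. {u, v} \<in> edges G \<longleftrightarrow> {f u, f v} \<in> edges H))"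

text \<open>Only the values of \<open>c\<close> on the edges of \<open>G\<close> matter. Natural numbers suffice as colours,
  since a finite graph uses only finitely many of them.\<close>

definition has_rainbow_copy :: "('a set \<Rightarrow> nat) \<Rightarrow> 'a graph \<Rightarrow> 'b graph \<Rightarrow> bool" where
  "has_rainbow_copy c G H \<longleftrightarrow>
     (\<exists>S. is_subgraph S G \<and> isomorphic S H \<and> inj_on c (edges S))"

definition forces_rainbow :: "nat \<Rightarrow> 'a graph \<Rightarrow> 'b graph \<Rightarrow> bool" where
  "forces_rainbow m G H \<longleftrightarrow>
     (\<forall>c :: 'a set \<Rightarrow> nat. m \<le> card (c ` edges G) \<longrightarrow> has_rainbow_copy c G H)"

definition rb :: "'a graph \<Rightarrow> 'b graph \<Rightarrow> nat" where
  "rb G H = (LEAST m. forces_rainbow m G H)"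

text \<open>The minimum is attained for every finite \<open>G\<close>: no colouring uses more colours than
  there are edges.\<close>

lemma forces_rainbow_rb:
  assumes "simple_graph G"
  shows "forces_rainbow (rb G H) G H"
proof -
  have "finite (edges G)"
    using assms by (auto simp: simple_graph_def intro: finite_subset[of _ "Pow (verts G)"])
  then have "card (c ` edges G) < Suc (card (edges G))" for c :: "'a set \<Rightarrow> nat"
    by (simp add: card_image_le le_imp_less_Suc)
  then have "forces_rainbow (Suc (card (edges G))) G H"
    by (simp add: forces_rainbow_def not_le[symmetric])
  then show ?thesis
    unfolding rb_def by (rule LeastI)
qed

lemma simple_graph_complete_graph: "simple_graph (complete_graph n)"
  by (simp add: simple_graph_def complete_graph_def)

end

theory Submission
  imports Defs "HOL-Library.Nat_Bijection"
begin

text \<open>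
  Lower bound: cut the vertices into blocks of size \<open>k - 1\<close>, give all edges inside blocks distinct
  colours and colour an edge between two blocks by the smaller block index. A \<open>k\<close>-cycle does not
  fit into a block, so it enters and leaves the first block it visits, by two edges of equal colour.

  Upper bound: induction on \<open>n\<close>. For \<open>n = p\<close> all edges have distinct colours. Otherwise, if deleting
  some vertex loses at most \<open>p - 2\<close> colours, delete it. If not, every vertex owns at
  least \<open>p - 1\<close> colours, occurring only on edges at that vertex. Hence from any vertex of a partial
  embedding of fewer than \<open>p\<close> vertices we can step to a fresh vertex along an edge whose colour is
  owned by the starting point and new. Build a path \<open>g\<^sub>0 \<leftarrow> g\<^sub>1 \<rightarrow> g\<^sub>2 \<rightarrow> \<dots> \<rightarrow> g\<^bsub>k-1\<^esub>\<close> of such steps.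
  The closing edge \<open>g\<^bsub>k-1\<^esub>g\<^sub>0\<close> avoids all owners, so the cycle is rainbow. The
  remaining edges of the unicyclic graph are added by further steps.
\<close>

section \<open>Edges as two-element subsets\<close>

definition pairs :: "'a set \<Rightarrow> 'a set set" where
  "pairs V = {e. e \<subseteq> V \<and> card e = 2}"

lemma finite_pairs: "finite V \<Longrightarrow> finite (pairs V)"
  by (rule finite_subset[of _ "Pow V"]) (auto simp: pairs_def)

lemma card_pairs: "finite V \<Longrightarrow> card (pairs V) = card V choose 2"
  by (simp add: pairs_def n_subsets)

lemma doubleton_in_pairs [simp]: "{u, v} \<in> pairs V \<longleftrightarrow> u \<in> V \<and> v \<in> V \<and> u \<noteq> v"
  by (auto simp: pairs_def card_2_iff doubleton_eq_iff)

lemma in_pairsE: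
  assumes "e \<in> pairs V" "u \<in> e"
  obtains v where "e = {u, v}" "v \<in> V" "v \<noteq> u"
  using assms by (auto simp: pairs_def card_2_iff)

lemma pairs_mono: "A \<subseteq> B \<Longrightarrow> pairs A \<subseteq> pairs B"
  by (auto simp: pairs_def)

lemma edges_complete_graph: "edges (complete_graph n) = pairs {..<n}"
  by (simp add: complete_graph_def pairs_def)

lemma image_in_pairs:
  assumes "inj_on f A" "f ` A \<subseteq> V" "e \<in> pairs A"
  shows "f ` e \<in> pairs V"
  using assms by (auto simp: pairs_def card_image inj_on_subset)

section \<open>Rainbow embeddings\<close>

text \<open>\<open>F\<close> is kept apart from \<open>A\<close> so that a partial embedding answers
  only for the edges placed so far; other pairs in \<open>A\<close> may repeat colours.\<close>

definition rainbow_embedding ::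
  "('b set \<Rightarrow> nat) \<Rightarrow> 'b set \<Rightarrow> 'a set \<Rightarrow> 'a set set \<Rightarrow> ('a \<Rightarrow> 'b) \<Rightarrow> bool" where
  "rainbow_embedding c V A F f \<longleftrightarrow>
     inj_on f A \<and> f ` A \<subseteq> V \<and> inj_on (\<lambda>e. c (f ` e)) F"

lemma has_rainbow_copyI:
  assumes H: "simple_graph H"
    and f: "rainbow_embedding c {..<n} (verts H) (edges H) f"
  shows "has_rainbow_copy c (complete_graph n) H"
proof -
  define S where "S = \<lparr>verts = f ` verts H, edges = (`) f ` edges H\<rparr>"
  have inj: "inj_on f (verts H)" and sub: "f ` verts H \<subseteq> {..<n}"
    and rain: "inj_on (\<lambda>e. c (f ` e)) (edges H)"
    using f by (auto simp: rainbow_embedding_def)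
  have E: "edges H \<subseteq> pairs (verts H)"
    using H by (auto simp: simple_graph_def pairs_def)
  have S_edges: "edges S \<subseteq> pairs (verts S)"
    using E image_in_pairs[OF inj] by (auto simp: S_def)
  have "is_subgraph S (complete_graph n)"
    unfolding is_subgraph_def edges_complete_graph
  proof (intro conjI)
    show "simple_graph S"
      using H S_edges by (auto simp: simple_graph_def S_def pairs_def)
    show "verts S \<subseteq> verts (complete_graph n)"
      using sub by (simp add: S_def complete_graph_def)
    show "edges S \<subseteq> pairs {..<n}"
      using S_edges pairs_mono[of "verts S" "{..<n}"] sub by (auto simp: S_def)
  qed
  moreover have "isomorphic S H"
    unfolding isomorphic_def
  proof (intro exI conjI ballI)
    let ?g = "inv_into (verts H) f"
    show "bij_betw ?g (verts S) (verts H)"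
      using inj by (auto simp: S_def intro: bij_betw_inv_into inj_on_imp_bij_betw)
    fix u v assume "u \<in> verts S" "v \<in> verts S"
    then obtain a b where ab: "a \<in> verts H" "b \<in> verts H" "u = f a" "v = f b"
      by (auto simp: S_def)
    have "{f a, f b} \<in> (`) f ` edges H \<longleftrightarrow> {a, b} \<in> edges H"
    proof
      assume "{f a, f b} \<in> (`) f ` edges H"
      then obtain e where e: "e \<in> edges H" "f ` {a, b} = f ` e" by auto
      moreover have "e \<subseteq> verts H" using e E by (auto simp: pairs_def)
      ultimately show "{a, b} \<in> edges H"
        using inj_on_image_eq_iff[OF inj, of "{a, b}" e] ab by auto
    qed (force intro: image_eqI[where x = "{a, b}"])
    then show "{u, v} \<in> edges S \<longleftrightarrow> {?g u, ?g v} \<in> edges H"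
      using ab inj by (simp add: S_def)
  qed
  moreover have "inj_on c (edges S)"
    using rain by (auto simp: S_def inj_on_def)
  ultimately show ?thesis
    by (auto simp: has_rainbow_copy_def)
qed

section \<open>Upper bound\<close>

text \<open>The colours lost by deleting \<open>u\<close>, so all their edges in \<open>V\<close>
  meet at \<open>u\<close>.\<close>

definition own_colours :: "('b set \<Rightarrow> nat) \<Rightarrow> 'b set \<Rightarrow> 'b \<Rightarrow> nat set" where
  "own_colours c V u = c ` pairs V - c ` pairs (V - {u})"

lemma own_colour_incident:
  assumes "c e \<in> own_colours c V u" "e' \<in> pairs V" "c e' = c e"
  shows "u \<in> e'"
proof (rule ccontr)
  assume "u \<notin> e'"
  then have "e' \<in> pairs (V - {u})"
    using assms(2) by (auto simp: pairs_def)
  then have "c e \<in> c ` pairs (V - {u})"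
    using assms(3) by (metis imageI)
  then show False
    using assms(1) by (simp add: own_colours_def)
qed

lemma card_colours_delete_vertex:
  assumes "finite V"
  shows "card (c ` pairs V) \<le> card (c ` pairs (V - {u})) + card (own_colours c V u)"
proof -
  have "c ` pairs V = c ` pairs (V - {u}) \<union> own_colours c V u"
    using pairs_mono[of "V - {u}" V] by (auto simp: own_colours_def)
  then show ?thesis
    by (simp add: card_Un_le)
qed

text \<open>Only \<open>card B - 1\<close> edges join \<open>u\<close> to the rest of
  \<open>B\<close>, so some owned colour is missing from them. All its edges in \<open>V\<close>
  contain \<open>u\<close>; hence one of them leaves \<open>B\<close> and none lies inside
  \<open>B\<close>.\<close>

lemma fresh_step:
  assumes fin: "finite B" and B: "B \<subseteq> V" and u: "u \<in> B"
    and card: "card B \<le> card (own_colours c V u)"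
  obtains y where "y \<in> V - B" "c {u, y} \<in> own_colours c V u" "c {u, y} \<notin> c ` pairs B"
proof -
  let ?D = "(\<lambda>b. c {u, b}) ` (B - {u})"
  have "card ?D \<le> card (B - {u})"
    using fin by (simp add: card_image_le)
  also have "\<dots> < card B"
    using fin u by (rule card_Diff1_less)
  finally have "card ?D < card (own_colours c V u)"
    using card by simp
  then have "\<not> own_colours c V u \<subseteq> ?D"
    using card_mono[of ?D "own_colours c V u"] fin by (meson finite_Diff finite_imageI not_le)
  then obtain x where x: "x \<in> own_colours c V u" "x \<notin> ?D" by blast
  then obtain e where e: "e \<in> pairs V" "x = c e"
    by (auto simp: own_colours_def)
  then have "u \<in> e"
    using x own_colour_incident by metis
  then obtain y where y: "e = {u, y}" "y \<in> V" "y \<noteq> u"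
    using e in_pairsE by metis
  have "x \<notin> c ` pairs B"
  proof
    assume "x \<in> c ` pairs B"
    then obtain e' where e': "e' \<in> pairs B" "c e' = x" by blast
    then have "u \<in> e'"
      using own_colour_incident[of c e V u e'] x e pairs_mono[OF B] by auto
    then show False
      using e' x by (auto elim: in_pairsE)
  qed
  moreover have "y \<in> V - B"
    using x e y by auto
  ultimately show ?thesis
    using that x e y by auto
qed

text \<open>\<open>max i 1\<close> records the backward first step: edges 0 and 1 both belong to
  \<open>g 1\<close>, each later edge \<open>i\<close> to \<open>g i\<close>. From three vertices
  on, only inner vertices of the path are owners. The bound \<open>j \<le> Suc q\<close> lets every
  fresh step start from at most \<open>q\<close> vertices.\<close>

lemma rainbow_path:
  assumes own: "\<And>u. u \<in> V \<Longrightarrow> q \<le> card (own_colours c V u)"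
    and "V \<noteq> {}" and "2 \<le> j" and "j \<le> Suc q"
  shows "\<exists>g. inj_on g {..<j} \<and> g ` {..<j} \<subseteq> V \<and>
    inj_on (\<lambda>i. c {g i, g (Suc i)}) {..<j - 1} \<and>
    (\<forall>i<j - 1. c {g i, g (Suc i)} \<in> own_colours c V (g (max i 1)))"
  using \<open>2 \<le> j\<close> \<open>j \<le> Suc q\<close>
proof (induction j rule: dec_induct)
  case base
  obtain u where u: "u \<in> V" using \<open>V \<noteq> {}\<close> by blast
  then have "card {u} \<le> card (own_colours c V u)"
    using own[OF u] base by simp
  then obtain y where y: "y \<in> V - {u}" "c {u, y} \<in> own_colours c V u"
    using fresh_step[of "{u}" V u c] u by auto
  \<comment> \<open>The starting vertex goes to position 1 and the fresh one to position 0.\<close>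
  let ?g = "\<lambda>i::nat. if i = 0 then y else u"
  have "inj_on ?g {..<2} \<and> ?g ` {..<2} \<subseteq> V \<and>
    inj_on (\<lambda>i. c {?g i, ?g (Suc i)}) {..<2 - 1} \<and>
    (\<forall>i<2 - 1. c {?g i, ?g (Suc i)} \<in> own_colours c V (?g (max i 1)))"
    using y u by (auto simp: inj_on_def insert_commute)
  then show ?case by blast
next
  case (step j)
  then obtain g where g: "inj_on g {..<j}" "g ` {..<j} \<subseteq> V"
    "inj_on (\<lambda>i. c {g i, g (Suc i)}) {..<j - 1}"
    "\<And>i. i < j - 1 \<Longrightarrow> c {g i, g (Suc i)} \<in> own_colours c V (g (max i 1))"
    by auto
  obtain m where m: "j = Suc m" "1 \<le> m" using step by (cases j) auto
  let ?B = "g ` {..<j}"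
  have "card ?B = j" "g m \<in> V"
    using g(1,2) m by (auto simp: card_image)
  then have "card ?B \<le> card (own_colours c V (g m))"
    using own[of "g m"] step.prems by linarith
  then obtain y where y: "y \<in> V - ?B" "c {g m, y} \<in> own_colours c V (g m)"
    "c {g m, y} \<notin> c ` pairs ?B"
    using fresh_step[of ?B V "g m" c] g m by auto
  let ?h = "g(j := y)"
  have old: "c {?h i, ?h (Suc i)} = c {g i, g (Suc i)}" if "i < m" for i
    using that m by simp
  have "inj_on ?h {..<Suc j}"
    using g(1) y by (auto simp: inj_on_def less_Suc_eq)
  moreover have "?h ` {..<Suc j} \<subseteq> V"
    using g(2) y by (auto simp: less_Suc_eq)
  moreover have "inj_on (\<lambda>i. c {?h i, ?h (Suc i)}) {..<Suc j - 1}"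
  proof -
    define col where "col i = c {?h i, ?h (Suc i)}" for i
    have col: "col i = c {g i, g (Suc i)}" if "i < m" for i
      using old[OF that] by (simp only: col_def)
    have "inj_on col {..<m}"
      using g(3) col m by (simp add: inj_on_def)
    moreover have "col i \<noteq> col m" if "i < m" for i
    proof -
      \<comment> \<open>Earlier edges lie inside \<open>?B\<close>, whose colours the new edge
        avoids.\<close>
      have "{g i, g (Suc i)} \<in> pairs ?B"
        using that m g(1) by (auto dest: inj_onD)
      then have "col i \<in> c ` pairs ?B"
        using col[OF that] by simp
      moreover have "col m = c {g m, y}"
        using m by (simp add: col_def)
      ultimately show ?thesis
        using y(3) by metis
    qed
    ultimately have "inj_on col (insert m {..<m})"
      by force
    then show ?thesis
      using m by (simp only: lessThan_Suc diff_Suc_1 col_def[abs_def])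
  qed
  moreover have "\<forall>i<Suc j - 1. c {?h i, ?h (Suc i)} \<in> own_colours c V (?h (max i 1))"
  proof (intro allI impI)
    fix i assume "i < Suc j - 1"
    then consider "i < m" | "i = m" using m by linarith
    then show "c {?h i, ?h (Suc i)} \<in> own_colours c V (?h (max i 1))"
    proof cases
      case 1
      then show ?thesis using g(4)[of i] m by auto
    next
      case 2
      then show ?thesis using y(2) m by (simp add: max_def)
    qed
  qed
  ultimately show ?case by blast
qed

lemma rainbow_cycle:
  assumes own: "\<And>u. u \<in> V \<Longrightarrow> q \<le> card (own_colours c V u)"
    and "V \<noteq> {}" and k: "3 \<le> k" and "k \<le> Suc q"
  shows "\<exists>g. inj_on g {..<k} \<and> g ` {..<k} \<subseteq> V \<and>
    inj_on (\<lambda>i. c {g i, g (Suc i mod k)}) {..<k}"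
proof -
  obtain m where m: "k = Suc m" "2 \<le> m" using k by (cases k) auto
  obtain g where g: "inj_on g {..<k}" "g ` {..<k} \<subseteq> V"
    "inj_on (\<lambda>i. c {g i, g (Suc i)}) {..<m}"
    "\<And>i. i < m \<Longrightarrow> c {g i, g (Suc i)} \<in> own_colours c V (g (max i 1))"
    using rainbow_path[of V q c k] assms m by auto
  have "inj_on (\<lambda>i. c {g i, g (Suc i mod k)}) {..<m}"
    using g(3) m by (simp add: inj_on_def)
  moreover have "c {g i, g (Suc i)} \<noteq> c {g m, g 0}" if "i < m" for i
  proof
    assume "c {g i, g (Suc i)} = c {g m, g 0}"
    moreover have "{g m, g 0} \<in> pairs V"
      using g(1,2) m by (auto dest: inj_onD)
    \<comment> \<open>The closing edge would have to contain the owner of the repeated colour, but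
      \<open>max i 1\<close> lies strictly between 0 and \<open>m\<close> because
      \<open>2 \<le> m\<close>.\<close>
    ultimately have "g (max i 1) \<in> {g m, g 0}"
      using own_colour_incident[OF g(4)[OF that]] by metis
    then show False
      using that m g(1) by (auto dest: inj_onD simp: max_def split: if_splits)
  qed
  then have "c {g m, g 0} \<notin> (\<lambda>i. c {g i, g (Suc i mod k)}) ` {..<m}"
    using m by fastforce
  ultimately have "inj_on (\<lambda>i. c {g i, g (Suc i mod k)}) (insert m {..<m})"
    using m by simp
  then have "inj_on (\<lambda>i. c {g i, g (Suc i mod k)}) {..<k}"
    using m by (simp only: lessThan_Suc)
  then show ?thesis using g by blast
qed

text \<open>If no edge left \<open>A\<close>, everything reachable from \<open>A\<close> would stay
  in \<open>A\<close>.\<close>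

lemma connected_graph_leaving_edge:
  assumes "connected_graph H" "A \<subseteq> verts H" "A \<noteq> {}" "A \<noteq> verts H"
    and "\<And>e. e \<in> edges H \<Longrightarrow> e \<subseteq> verts H"
  obtains a x where "a \<in> A" "x \<in> verts H - A" "{a, x} \<in> edges H"
proof (rule ccontr)
  assume no: "\<not> thesis"
  obtain u v where u: "u \<in> A" and v: "v \<in> verts H - A" using assms by blast
  have "(u, v) \<in> {(x, y). {x, y} \<in> edges H}\<^sup>*"
    using assms(1,2) u v by (auto simp: connected_graph_def)
  then have "v \<in> A"
  proof (induction rule: rtrancl_induct)
    case base
    show ?case by (rule u)
  next
    case (step y z)
    then show ?case using no that assms(5) by blast
  qed
  with v show False by blast
qed

text \<open>No cycle other than the given one has to be excluded: the invariant \<open>card F = card A\<close>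
  forces \<open>F = edges H\<close> at the end.\<close>

lemma extend_rainbow_embedding:
  assumes H: "simple_graph H" "connected_graph H" "card (edges H) = card (verts H)"
    and own: "\<And>u. u \<in> V \<Longrightarrow> card (verts H) \<le> Suc (card (own_colours c V u))"
    and "A \<subseteq> verts H" "A \<noteq> {}" "F \<subseteq> edges H" "F \<subseteq> pairs A" "card F = card A"
    and "rainbow_embedding c V A F f"
  shows "\<exists>f. rainbow_embedding c V (verts H) (edges H) f"
  using assms(5-)
proof (induction "card (verts H) - card A" arbitrary: A F f)
  case 0
  have finH: "finite (verts H)" using H(1) by (simp add: simple_graph_def)
  moreover have "edges H \<subseteq> pairs (verts H)"
    using H(1) by (auto simp: simple_graph_def pairs_def)
  ultimately have finE: "finite (edges H)"
    using finite_pairs finite_subset by blast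
  have A: "A = verts H"
    using 0(1) by (intro card_seteq[OF finH 0(2)]) simp
  have "F = edges H"
    by (intro card_subset_eq[OF finE 0(4)]) (simp only: 0(6) H(3) A)
  then show ?case using 0(7) A by blast
next
  case (Suc d)
  have finA: "finite A"
    using H(1) Suc.prems(1) finite_subset by (auto simp: simple_graph_def)
  then have finF: "finite F"
    using Suc.prems(4) finite_pairs finite_subset by blast
  have "A \<noteq> verts H" using Suc.hyps(2) by auto
  then obtain a x where ax: "a \<in> A" "x \<in> verts H - A" "{a, x} \<in> edges H"
    using connected_graph_leaving_edge[of H A] H Suc.prems by (auto simp: simple_graph_def)
  have f: "inj_on f A" "f ` A \<subseteq> V" "inj_on (\<lambda>e. c (f ` e)) F"
    using Suc.prems by (auto simp: rainbow_embedding_def)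
  \<comment> \<open>Here \<open>A\<close> misses at least one vertex of \<open>H\<close>, so
    \<open>card A\<close> is at most the number of colours owned by any vertex of
    \<open>V\<close>.\<close>
  have "card (f ` A) \<le> card (own_colours c V (f a))"
    using own[of "f a"] f ax Suc.hyps(2) by (auto simp: card_image)
  then obtain y where y: "y \<in> V - f ` A" "c {f a, y} \<notin> c ` pairs (f ` A)"
    using fresh_step[of "f ` A" V "f a" c] finA f ax by (metis finite_imageI imageI)
  let ?g = "f(x := y)" and ?A = "insert x A" and ?F = "insert {a, x} F"
  have img: "?g ` e = f ` e" if "e \<in> F" for e
    using that Suc.prems(4) ax by (auto simp: pairs_def)
  have new: "{a, x} \<notin> F"
    using Suc.prems(4) ax by (auto simp: pairs_def)
  have "inj_on (\<lambda>e. c (?g ` e)) ?F"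
  proof -
    have "inj_on (\<lambda>e. c (?g ` e)) F"
      using f(3) img by (simp add: inj_on_def)
    \<comment> \<open>Old edges land among the pairs inside the image of \<open>A\<close>, where the
      new colour is absent.\<close>
    moreover have "c (?g ` e) \<noteq> c {f a, y}" if "e \<in> F" for e
      using y(2) img[OF that] image_in_pairs[OF f(1) subset_refl, of e] Suc.prems(4) that
      by (metis image_eqI subsetD)
    moreover have "?g ` {a, x} = {f a, y}" using ax by auto
    ultimately have "c (?g ` {a, x}) \<notin> (\<lambda>e. c (?g ` e)) ` F"
      by force
    then show ?thesis using \<open>inj_on (\<lambda>e. c (?g ` e)) F\<close> new by simp
  qed
  moreover have "inj_on ?g ?A" "?g ` ?A \<subseteq> V"
    using f y ax by (auto simp: inj_on_def)
  ultimately have "rainbow_embedding c V ?A ?F ?g"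
    by (simp add: rainbow_embedding_def)
  moreover have "?F \<subseteq> pairs ?A"
    using Suc.prems(4) pairs_mono[of A ?A] ax by auto
  moreover have "card ?F = card ?A"
    using new finA finF ax Suc.prems(5) by simp
  moreover have "d = card (verts H) - card ?A"
    using Suc.hyps(2) finA ax by simp
  ultimately show ?case
    using Suc.hyps(1)[of ?A ?F ?g] Suc.prems ax by auto
qed

text \<open>Carries a rainbow cycle indexed by positions over to \<open>H\<close>; its
  \<open>k\<close> edges on \<open>k\<close> vertices are the starting point for the
  extension.\<close>

lemma cycle_rainbow_embedding:
  assumes vs: "is_cycle H vs" and k: "length vs = k"
    and g: "inj_on g {..<k}" "g ` {..<k} \<subseteq> V" "inj_on (\<lambda>i. c {g i, g (Suc i mod k)}) {..<k}"
  obtains F f where "F \<subseteq> edges H" "F \<subseteq> pairs (set vs)" "card F = k"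
    "rainbow_embedding c V (set vs) F f"
proof -
  define f where "f = g \<circ> inv_into {..<k} ((!) vs)"
  define e where "e i = {vs ! i, vs ! (Suc i mod k)}" for i
  have dist: "distinct vs" and "3 \<le> k" using vs k by (auto simp: is_cycle_def)
  have inj: "inj_on ((!) vs) {..<k}"
    using dist k by (simp add: inj_on_nth)
  have set_vs: "set vs = (!) vs ` {..<k}"
    using k by (auto simp: set_conv_nth)
  have f: "f (vs ! i) = g i" if "i < k" for i
    using that inj by (simp add: f_def)
  have fe: "f ` e i = {g i, g (Suc i mod k)}" if "i < k" for i
    using that f[of i] f[of "Suc i mod k"] by (simp add: e_def)
  have colours: "inj_on ((\<lambda>e. c (f ` e)) \<circ> e) {..<k}"
    using g(3) fe by (simp add: inj_on_def)
  have "e ` {..<k} \<subseteq> edges H"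
    using vs k by (auto simp: is_cycle_def e_def)
  moreover have "e ` {..<k} \<subseteq> pairs (set vs)"
  proof (rule image_subsetI)
    fix i assume "i \<in> {..<k}"
    moreover from this have "Suc i mod k \<noteq> i" "Suc i mod k < k"
      using \<open>3 \<le> k\<close> by (auto simp: mod_Suc)
    ultimately show "e i \<in> pairs (set vs)"
      using dist k by (simp add: e_def nth_eq_iff_index_eq)
  qed
  \<comment> \<open>Distinct colours already force the \<open>k\<close> edges to be
    distinct.\<close>
  moreover have "card (e ` {..<k}) = k"
    using colours by (simp add: card_image inj_on_imageI2)
  moreover have "rainbow_embedding c V (set vs) (e ` {..<k}) f"
    unfolding rainbow_embedding_def
  proof (intro conjI)
    show "inj_on f (set vs)"
      unfolding set_vs using g(1) f by (auto simp: inj_on_def)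
    show "f ` set vs \<subseteq> V"
      unfolding set_vs using g(2) f by auto
    show "inj_on (\<lambda>e. c (f ` e)) (e ` {..<k})"
      using colours by (rule inj_on_imageI)
  qed
  ultimately show ?thesis by (rule that)
qed

text \<open>\<open>V\<close> is arbitrary because the induction may delete any vertex. The colour
  bound is stated additively to avoid truncated subtraction; it survives a deletion because its left
  side drops by \<open>p - 2\<close>, which is at least the number of colours lost.\<close>

lemma unicyclic_rainbow_embedding:
  assumes H: "simple_graph H" "connected_graph H" "card (edges H) = card (verts H)"
    and vs: "is_cycle H vs" and p: "card (verts H) = p"
    and "finite V" "p \<le> card V"
    and "(p - 2) * card V \<le> card (c ` pairs V) + p * (p - 3) div 2"
  shows "\<exists>f. rainbow_embedding c V (verts H) (edges H) f"
  using assms(6-)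
proof (induction "card V - p" arbitrary: V)
  case 0
  have finH: "finite (verts H)" using H by (simp add: simple_graph_def)
  have card_le: "length vs \<le> p" and "3 \<le> length vs"
    using vs p card_mono[OF finH, of "set vs"] by (auto simp: is_cycle_def distinct_card)
  then have "3 \<le> p" by simp
  have V: "card V = p" using 0 by simp
  obtain s where s: "p = s + 3" using \<open>3 \<le> p\<close> by (metis add.commute le_Suc_ex)
  \<comment> \<open>At \<open>card V = p\<close> the threshold
    \<open>p * (p - 2) - p * (p - 3) / 2\<close> equals \<open>p * (p - 1) / 2\<close>, the number
    of all edges. Writing \<open>p = s + 3\<close> removes the nested subtractions.\<close>
  have "p choose 2 \<le> card (c ` pairs V)"
  proof -
    have "(s + 1) * (s + 3) - (s + 3) * s div 2 = (s + 3) * (s + 2) div 2"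
    proof -
      have "2 * ((s + 3) * s div 2) = (s + 3) * s" "2 * ((s + 3) * (s + 2) div 2) = (s + 3) * (s + 2)"
        by simp_all
      then have "2 * ((s + 3) * s div 2) + 2 * ((s + 3) * (s + 2) div 2) = 2 * ((s + 1) * (s + 3))"
        by (simp only:) (simp add: algebra_simps)
      then show ?thesis by linarith
    qed
    then show ?thesis
      using 0 V by (simp add: s choose_two)
  qed
  then have "card (c ` pairs V) = card (pairs V)"
    using card_image_le[OF finite_pairs, of V c] 0 V by (simp add: card_pairs)
  then have c: "inj_on c (pairs V)"
    using 0 finite_pairs by (metis eq_card_imp_inj_on)
  obtain f where f: "inj_on f (verts H)" "f ` verts H = V"
    using finite_same_card_bij[OF finH, of V] 0 V p by (auto simp: bij_betw_def)
  have E: "edges H \<subseteq> pairs (verts H)"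
    using H by (auto simp: simple_graph_def pairs_def)
  have "inj_on (\<lambda>e. c (f ` e)) (edges H)"
  proof (rule inj_onI)
    fix e e' assume e: "e \<in> edges H" "e' \<in> edges H" "c (f ` e) = c (f ` e')"
    then have "f ` e = f ` e'"
      using image_in_pairs[OF f(1)] f(2) E by (intro inj_onD[OF c]) auto
    then show "e = e'"
      using inj_on_image_eq_iff[OF f(1), of e e'] e E by (simp add: pairs_def subset_iff)
  qed
  then show ?case using f by (auto simp: rainbow_embedding_def)
next
  case (Suc d)
  have finH: "finite (verts H)" using H by (simp add: simple_graph_def)
  have card_le: "length vs \<le> p" and "3 \<le> length vs"
    using vs p card_mono[OF finH, of "set vs"] by (auto simp: is_cycle_def distinct_card)
  show ?case
  proof (cases "\<exists>v\<in>V. card (own_colours c V v) \<le> p - 2")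
    case True
    then obtain v where v: "v \<in> V" "card (own_colours c V v) \<le> p - 2" by blast
    obtain N where N: "card V = Suc N" "card (V - {v}) = N"
      using v Suc.prems by (cases "card V") auto
    have "(p - 2) * Suc N \<le> card (c ` pairs (V - {v})) + (p - 2) + p * (p - 3) div 2"
      using card_colours_delete_vertex[OF Suc.prems(1), of c v] v Suc.prems(3) N by simp
    then have "(p - 2) * card (V - {v}) \<le> card (c ` pairs (V - {v})) + p * (p - 3) div 2"
      using N by simp
    moreover have "d = card (V - {v}) - p" "p \<le> card (V - {v})"
      using Suc.hyps(2) N by auto
    ultimately obtain f where "rainbow_embedding c (V - {v}) (verts H) (edges H) f"
      using Suc.hyps(1)[of "V - {v}"] Suc.prems by auto
    then have "rainbow_embedding c V (verts H) (edges H) f" by (auto simp: rainbow_embedding_def)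
    then show ?thesis by blast
  next
    case False
    \<comment> \<open>With \<open>p - 1\<close> owned colours everywhere, fresh steps are possible
      until \<open>p\<close> vertices are reached.\<close>
    have own: "p - 1 \<le> card (own_colours c V u)" if "u \<in> V" for u
      using False that by fastforce
    have "V \<noteq> {}" using Suc.hyps(2) by auto
    then obtain g where "inj_on g {..<length vs}" "g ` {..<length vs} \<subseteq> V"
      "inj_on (\<lambda>i. c {g i, g (Suc i mod length vs)}) {..<length vs}"
      using rainbow_cycle[of V "p - 1" c "length vs"] own Suc.prems card_le \<open>3 \<le> length vs\<close> by auto
    then obtain F f where F: "F \<subseteq> edges H" "F \<subseteq> pairs (set vs)" "card F = length vs"
      "rainbow_embedding c V (set vs) F f"
      by (rule cycle_rainbow_embedding[OF vs refl])
    show ?thesis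
    proof (rule extend_rainbow_embedding[OF H _ _ _ F(1,2) _ F(4)])
      show "card (verts H) \<le> Suc (card (own_colours c V u))" if "u \<in> V" for u
        using own[OF that] p by simp
      show "set vs \<subseteq> verts H" "set vs \<noteq> {}" "card F = card (set vs)"
        using vs F(3) \<open>3 \<le> length vs\<close> by (auto simp: is_cycle_def distinct_card)
    qed
  qed
qed

section \<open>Lower bound\<close>

text \<open>The vertex \<open>i\<close> lies in the block \<open>i div d\<close>. Odd colours are used inside the blocks, even
  colours between them.\<close>

definition block_colouring :: "nat \<Rightarrow> nat set \<Rightarrow> nat" where
  "block_colouring d e =
     (if Min e div d = Max e div d then Suc (2 * prod_encode (Min e, Max e))
      else 2 * (Min e div d))"

lemma block_colouring_pair:
  assumes "a < b"
  shows "block_colouring d {a, b} =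
    (if a div d = b div d then Suc (2 * prod_encode (a, b)) else 2 * (a div d))"
  using assms by (simp add: block_colouring_def)

lemma block_colouring_cross:
  assumes "a div d < b div d"
  shows "block_colouring d {a, b} = 2 * (a div d)"
proof -
  have "a < b" using assms by (meson div_le_mono not_le)
  then show ?thesis using assms by (simp add: block_colouring_pair)
qed

text \<open>\<open>b mod d\<close> counts the vertices before \<open>b\<close> in its block, so the
  sum counts the pairs inside blocks: \<open>n div d\<close> full blocks and a remainder of size
  \<open>n mod d\<close>.\<close>

lemma sum_mod:
  assumes "0 < d"
  shows "(\<Sum>b<n. b mod d) = (n div d) * (d choose 2) + (n mod d choose 2)"
proof (induction n)
  case (Suc n)
  have *: "Suc m choose 2 = m + (m choose 2)" for m
    by (simp add: numeral_2_eq_2)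
  \<comment> \<open>The split is on whether vertex \<open>n\<close> completes its block.\<close>
  show ?case
  proof (cases "Suc (n mod d) = d")
    case True
    then have "d choose 2 = n mod d + (n mod d choose 2)" using * by metis
    then show ?thesis
      using Suc True by (simp add: div_Suc mod_Suc binomial_eq_0)
  next
    case False
    then show ?thesis
      using Suc by (simp add: div_Suc mod_Suc *)
  qed
qed (simp add: binomial_eq_0)

text \<open>For \<open>0 < n\<close> the last block has index \<open>(n - 1) div d\<close>; each
  earlier block contributes one more colour through an edge to its successor.\<close>

lemma card_block_colours:
  assumes d: "0 < d"
  shows "(n div d) * (d choose 2) + (n mod d choose 2) + (n - 1) div d
    \<le> card (block_colouring d ` pairs {..<n})"
proof -
  \<comment> \<open>\<open>b - b mod d\<close> is the first vertex of the block of \<open>b\<close>,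
    so \<open>I\<close> lists the edges inside blocks by their larger end.\<close>
  define I where "I = (SIGMA b:{..<n}. {b - b mod d..<b})"
  define inside where "inside = (\<lambda>(b, a). Suc (2 * prod_encode (a, b))) ` I"
  define cross where "cross = (*) 2 ` {..<(n - 1) div d}"
  have "card inside = card I"
    unfolding inside_def by (rule card_image) (auto simp: inj_on_def)
  also have "\<dots> = (\<Sum>b<n. b mod d)"
    unfolding I_def by simp
  finally have inside: "card inside = (n div d) * (d choose 2) + (n mod d choose 2)"
    using sum_mod[OF d] by simp
  have cross: "card cross = (n - 1) div d"
    by (simp add: cross_def card_image inj_on_def)
  have fin: "finite inside" "finite cross"
    by (simp_all add: inside_def cross_def I_def)
  have "inside \<inter> cross = {}"
  proof -
    have "Suc (2 * u) \<noteq> 2 * v" for u v :: nat by presburger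
    then show ?thesis by (auto simp: inside_def cross_def)
  qed
  then have "card (inside \<union> cross) = card inside + card cross"
    using fin by (simp add: card_Un_disjoint)
  moreover have "inside \<subseteq> block_colouring d ` pairs {..<n}"
  proof
    fix x assume "x \<in> inside"
    then obtain a b where ab: "b < n" "b - b mod d \<le> a" "a < b" "x = Suc (2 * prod_encode (a, b))"
      by (auto simp: inside_def I_def)
    have "b div d * d \<le> a" using ab(2) by (simp add: minus_mod_eq_div_mult)
    then have "b div d \<le> a div d" using d by (simp add: less_eq_div_iff_mult_less_eq)
    then have "a div d = b div d" using ab(3) by (simp add: div_le_mono le_antisym)
    then have "x = block_colouring d {a, b}" using ab by (simp add: block_colouring_pair)
    then show "x \<in> block_colouring d ` pairs {..<n}" using ab by auto
  qed
  moreover have "cross \<subseteq> block_colouring d ` pairs {..<n}"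
  proof
    fix x assume "x \<in> cross"
    then obtain j where j: "j < (n - 1) div d" "x = 2 * j" by (auto simp: cross_def)
    have "Suc j * d \<le> n - 1"
      using j d less_eq_div_iff_mult_less_eq[of d "Suc j" "n - 1"] by (simp only: Suc_le_eq)
    moreover have "0 < n" using j by (cases n) auto
    \<comment> \<open>These are the first vertices of blocks \<open>j\<close> and
      \<open>Suc j\<close>; the second exists since \<open>Suc j\<close> is at most the last block
      index.\<close>
    ultimately have "{j * d, Suc j * d} \<in> pairs {..<n}" using d by auto
    moreover have "x = block_colouring d {j * d, Suc j * d}"
      using block_colouring_cross[of "j * d" d "Suc j * d"] d j by simp
    ultimately show "x \<in> block_colouring d ` pairs {..<n}" by blast
  qed
  ultimately show ?thesis
    using card_mono[of "block_colouring d ` pairs {..<n}" "inside \<union> cross"]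
    by (simp add: inside cross finite_pairs)
qed

section \<open>Crossings between blocks along a cycle\<close>

lemma crossing_index:
  assumes "P i" "\<not> P j" "(i::nat) \<le> j"
  obtains l where "i \<le> l" "P l" "\<not> P (Suc l)"
  using assms(3,1,2) that by (induction rule: dec_induct) blast+

lemma block_colouring_cycle:
  assumes k: "3 \<le> k" and w: "inj_on w {..<k}"
  obtains i j where "i < k" "j < k" "{w i, w (Suc i mod k)} \<noteq> {w j, w (Suc j mod k)}"
    "block_colouring (k - 1) {w i, w (Suc i mod k)} = block_colouring (k - 1) {w j, w (Suc j mod k)}"
proof -
  define m where "m = Min ((\<lambda>i. w i div (k - 1)) ` {..<k})"
  \<comment> \<open>Indices are read modulo \<open>k\<close> so that a walk along the cycle may wrap
    around.\<close>
  define P where "P i \<longleftrightarrow> w (i mod k) div (k - 1) = m" for i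
  have m_le: "m \<le> w i div (k - 1)" if "i < k" for i
    using that by (simp add: m_def)
  have "m \<in> (\<lambda>i. w i div (k - 1)) ` {..<k}"
    unfolding m_def using k by (intro Min_in) (auto simp: lessThan_empty_iff bot_nat_def)
  then obtain i0 where i0: "i0 < k" "P i0" by (auto simp: P_def)
  have "\<exists>j<k. \<not> P j"
  proof (rule ccontr)
    assume "\<not> ?thesis"
    then have *: "w i div (k - 1) = m" if "i < k" for i using that by (auto simp: P_def)
    \<comment> \<open>Otherwise \<open>k\<close> distinct vertices would lie in a block of
      \<open>k - 1\<close> integers.\<close>
    have "w ` {..<k} \<subseteq> {m * (k - 1)..<m * (k - 1) + (k - 1)}"
    proof (rule image_subsetI)
      fix i assume "i \<in> {..<k}"
      then have "w i = m * (k - 1) + w i mod (k - 1)"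
        using *[of i] by (metis div_mult_mod_eq lessThan_iff)
      moreover have "w i mod (k - 1) < k - 1" using k by simp
      ultimately show "w i \<in> {m * (k - 1)..<m * (k - 1) + (k - 1)}"
        by (metis atLeastLessThan_iff le_add1 nat_add_left_cancel_less)
    qed
    then have "card (w ` {..<k}) \<le> card {m * (k - 1)..<m * (k - 1) + (k - 1)}"
      by (intro card_mono) auto
    then show False using w k by (simp add: card_image)
  qed
  then obtain j0 where j0: "j0 < k" "\<not> P j0" by blast
  have shift: "P (i + k) \<longleftrightarrow> P i" for i by (simp add: P_def)
  \<comment> \<open>Adding \<open>k\<close> to the target index puts it beyond the start. The first
    walk finds an exit from block \<open>m\<close>, the second an entry into it.\<close>
  obtain i where i: "P i" "\<not> P (Suc i)"
    using crossing_index[of P i0 "j0 + k"] i0 j0 shift by auto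
  obtain j where j: "\<not> P j" "P (Suc j)"
    using crossing_index[of "\<lambda>l. \<not> P l" j0 "i0 + k"] i0 j0 shift by auto
  have Suc_mod: "Suc (l mod k) mod k = Suc l mod k" for l by (simp add: mod_Suc_eq)
  have lt: "l mod k < k" for l using k by simp
  \<comment> \<open>By minimality of \<open>m\<close>, the endpoint outside block \<open>m\<close>
    lies in a later block, so both crossing edges take colour \<open>2 * m\<close>.\<close>
  have "block_colouring (k - 1) {w (i mod k), w (Suc i mod k)} = 2 * m"
    using block_colouring_cross[of "w (i mod k)" "k - 1" "w (Suc i mod k)"] i m_le[OF lt, of "Suc i"]
    by (simp add: P_def)
  moreover have "block_colouring (k - 1) {w (j mod k), w (Suc j mod k)} = 2 * m"
    using block_colouring_cross[of "w (Suc j mod k)" "k - 1" "w (j mod k)"] j m_le[OF lt, of "j"]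
    by (simp add: P_def insert_commute)
  moreover have "{w (i mod k), w (Suc i mod k)} \<noteq> {w (j mod k), w (Suc j mod k)}"
  proof
    assume "{w (i mod k), w (Suc i mod k)} = {w (j mod k), w (Suc j mod k)}"
    \<comment> \<open>One edge starts in block \<open>m\<close> and the other outside, so equal
      edges would be traversed in opposite directions. Two steps along the cycle would then return
      to the start, which is impossible for \<open>3 \<le> k\<close>.\<close>
    moreover have "w (i mod k) \<noteq> w (j mod k)" using i j by (auto simp: P_def)
    ultimately have "w (i mod k) = w (Suc j mod k)" "w (Suc i mod k) = w (j mod k)"
      by (auto simp: doubleton_eq_iff)
    then have "i mod k = Suc j mod k" "Suc i mod k = j mod k"
      using inj_onD[OF w] lt by auto
    then have "j mod k = Suc (Suc (j mod k) mod k) mod k" by (metis mod_Suc_eq)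
    moreover have "a \<noteq> Suc (Suc a mod k) mod k" if "a < k" for a
      using that k by (cases "Suc a = k"; cases "Suc (Suc a) = k") auto
    ultimately show False using lt by blast
  qed
  ultimately show ?thesis
    using that[of "i mod k" "j mod k"] lt Suc_mod by simp
qed

text \<open>A copy of \<open>H\<close> contains the preimage of its \<open>k\<close>-cycle, and two
  edges of that preimage share a colour.\<close>

lemma block_colouring_no_rainbow_copy:
  assumes vs: "is_cycle H vs" and k: "length vs = k"
  shows "\<not> has_rainbow_copy (block_colouring (k - 1)) G H"
proof
  assume "has_rainbow_copy (block_colouring (k - 1)) G H"
  then obtain S :: "nat graph" and f where inj: "inj_on (block_colouring (k - 1)) (edges S)"
    and f: "bij_betw f (verts S) (verts H)"
    and edge: "\<forall>u\<in>verts S. \<forall>v\<in>verts S. {u, v} \<in> edges S \<longleftrightarrow> {f u, f v} \<in> edges H"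
    unfolding has_rainbow_copy_def isomorphic_def by blast
  define w where "w i = inv_into (verts S) f (vs ! i)" for i
  have k3: "3 \<le> k" and dist: "distinct vs" and sub: "set vs \<subseteq> verts H"
    and cyc: "\<And>i. i < k \<Longrightarrow> {vs ! i, vs ! (Suc i mod k)} \<in> edges H"
    using vs k by (auto simp: is_cycle_def)
  have vsH: "vs ! i \<in> f ` verts S" if "i < k" for i
    using that sub k f nth_mem by (fastforce simp: bij_betw_def)
  have fw: "f (w i) = vs ! i" "w i \<in> verts S" if "i < k" for i
    using vsH[OF that] by (simp_all add: w_def f_inv_into_f inv_into_into)
  have "inj_on w {..<k}"
  proof (rule inj_onI)
    fix i j assume ij: "i \<in> {..<k}" "j \<in> {..<k}" "w i = w j"
    then have "vs ! i = vs ! j"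
      using fw(1)[of i] fw(1)[of j] by (metis lessThan_iff)
    then show "i = j"
      using ij dist k by (simp add: nth_eq_iff_index_eq)
  qed
  then obtain i j where ij: "i < k" "j < k"
    "{w i, w (Suc i mod k)} \<noteq> {w j, w (Suc j mod k)}"
    "block_colouring (k - 1) {w i, w (Suc i mod k)} = block_colouring (k - 1) {w j, w (Suc j mod k)}"
    by (rule block_colouring_cycle[OF k3])
  have "{w l, w (Suc l mod k)} \<in> edges S" if "l < k" for l
    using edge fw[of l] fw[of "Suc l mod k"] cyc[OF that] that by (metis mod_less_divisor gr_implies_not0 gr0I)
  then show False
    using inj_onD[OF inj ij(4)] ij(1-3) by blast
qed

section \<open>Assembling both bounds in the real numbers\<close>

theorem theorem5:
  fixes H :: "'a graph" and p k n r :: nat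
  assumes "simple_graph H"
    and "connected_graph H"
    and "card (verts H) = p"
    and "5 \<le> p"
    and "cyclomatic_number H = 1"
    and "\<exists>vs. is_cycle H vs \<and> length vs = k"
    and "3 \<le> k" and "k \<le> p - 2"
    and "p \<le> n"
    and "r = n mod (k - 1)"
  shows "real_of_int \<lfloor>real n / (real k - 1)\<rfloor> * real ((k - 1) choose 2) + real (r choose 2)
           + real_of_int \<lceil>real n / (real k - 1)\<rceil> \<le> real (rb (complete_graph n) H)
       \<and> real (rb (complete_graph n) H)
           \<le> (real p - 2) * real n - real p * ((real p - 3) / 2)"
proof
  obtain vs where vs: "is_cycle H vs" "length vs = k" using assms(6) by blast
  define d where "d = k - 1"
  have d: "0 < d" and real_d: "real k - 1 = real d" using \<open>3 \<le> k\<close> by (auto simp: d_def)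
  have "\<not> card (block_colouring d ` edges (complete_graph n)) \<ge> rb (complete_graph n) H"
    using block_colouring_no_rainbow_copy[OF vs]
      forces_rainbow_rb[OF simple_graph_complete_graph, of n H]
    by (auto simp: forces_rainbow_def d_def)
  \<comment> \<open>Strictness adds 1 to \<open>(n - 1) div d\<close>, which lifts it to the ceiling
    of \<open>n / d\<close>.\<close>
  then have "(n div d) * (d choose 2) + (n mod d choose 2) + Suc ((n - 1) div d)
      \<le> rb (complete_graph n) H"
    using card_block_colours[OF d, of n] by (simp add: edges_complete_graph)
  then have "real (n div d) * real (d choose 2) + real (n mod d choose 2)
      + real (Suc ((n - 1) div d)) \<le> real (rb (complete_graph n) H)"
    by (simp only: of_nat_add[symmetric] of_nat_mult[symmetric] of_nat_le_iff)
  moreover have "real_of_int \<lfloor>real n / real d\<rfloor> = real (n div d)"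
    by (simp add: floor_divide_of_nat_eq)
  moreover have "real_of_int \<lceil>real n / real d\<rceil> \<le> real (Suc ((n - 1) div d))"
  proof -
    have "n - 1 < Suc ((n - 1) div d) * d"
      using d dividend_less_div_times[of d "n - 1"] by simp
    then have "n \<le> Suc ((n - 1) div d) * d" by simp
    then have "real n \<le> real (Suc ((n - 1) div d)) * real d"
      by (simp only: of_nat_mult[symmetric] of_nat_le_iff)
    then have "real n / real d \<le> of_int (int (Suc ((n - 1) div d)))"
      using d by (simp add: divide_le_eq)
    then have "\<lceil>real n / real d\<rceil> \<le> int (Suc ((n - 1) div d))"
      by (rule ceiling_le)
    then show ?thesis by linarith
  qed
  ultimately show "real_of_int \<lfloor>real n / (real k - 1)\<rfloor> * real ((k - 1) choose 2)
      + real (r choose 2) + real_of_int \<lceil>real n / (real k - 1)\<rceil> \<le> real (rb (complete_graph n) H)"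
    unfolding real_d \<open>r = n mod (k - 1)\<close> d_def[symmetric] by simp
next
  obtain vs where vs: "is_cycle H vs" using assms(6) by blast
  have card_eq: "card (edges H) = card (verts H)"
    using \<open>cyclomatic_number H = 1\<close> by (simp add: cyclomatic_number_def)
  define M where "M = (p - 2) * n - p * (p - 3) div 2"
  have "forces_rainbow M (complete_graph n) H"
    unfolding forces_rainbow_def edges_complete_graph
  proof (intro allI impI)
    fix c :: "nat set \<Rightarrow> nat" assume "M \<le> card (c ` pairs {..<n})"
    then have "(p - 2) * card {..<n} \<le> card (c ` pairs {..<n}) + p * (p - 3) div 2"
      unfolding M_def by (simp only: card_lessThan le_diff_conv)
    then obtain f where "rainbow_embedding c {..<n} (verts H) (edges H) f"
      using unicyclic_rainbow_embedding[OF assms(1,2) card_eq vs assms(3), of "{..<n}" c] \<open>p \<le> n\<close>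
      by auto
    then show "has_rainbow_copy c (complete_graph n) H"
      by (rule has_rainbow_copyI[OF assms(1)])
  qed
  then have "rb (complete_graph n) H \<le> M"
    unfolding rb_def by (rule Least_le)
  moreover have "real M = (real p - 2) * real n - real p * ((real p - 3) / 2)"
  proof -
    \<comment> \<open>One of \<open>p\<close> and \<open>p - 3\<close> is even, so the division is
      exact; the inequality below rules out truncation of the subtraction in
      \<open>M\<close>.\<close>
    have "even (p * (p - 3))" using \<open>5 \<le> p\<close> by auto
    then have half: "real (p * (p - 3) div 2) = real p * ((real p - 3) / 2)"
      using \<open>5 \<le> p\<close> by (simp add: real_of_nat_div)
    have "p * (p - 3) div 2 \<le> p * (p - 3)" by simp
    also have "\<dots> \<le> (p - 2) * n"
      using \<open>p \<le> n\<close> mult_le_mono[of p n "p - 3" "p - 2"] by (simp add: mult.commute)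
    finally show ?thesis
      using half \<open>5 \<le> p\<close> by (simp add: M_def)
  qed
  ultimately show "real (rb (complete_graph n) H)
      \<le> (real p - 2) * real n - real p * ((real p - 3) / 2)"
    by (metis of_nat_le_iff)
qed

end
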